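(* Let $\mathcal A$ and $\mathcal B$ be non-empty finite alphabets, let $X\subset\mathcal A^{\mathbb Z}$ be any subshift, let $\sigma:\mathcal A^*\to\mathcal B^*$ be a non-erasing morphism of free monoids, and let $Y:=\sigma(X)$ be the image subshift of $X$. Then the topological entropies $h_X$ and $h_Y$ satisfy: (1) Without any further hypotheses, $h_Y\le h_X$. (2) If $\sigma$ is recognizable in $X$ and letter-to-letter, then $h_Y=h_X$. (3) There exist non-empty finite alphabets $\mathcal A,\mathcal B$, subshifts $X\subset\mathcal A^{\mathbb Z}$ and non-erasing morphisms $\sigma:\mathcal A^*\to\mathcal B^*$ which are recognizable in $X$ (but not letter-to-letter) such that, for $Y=\sigma(X)$, one has $h_Y<h_X$.
   Context: For a finite alphabet $\mathcal A$, $\mathcal A^*$ is the free monoid of finite words in $\mathcal A$ and $|w|$ is the length of a word $w$. The space $\mathcal A^{\mathbb Z}$ of biinfinite words ${\bf x} = \ldots x_{n-1}x_nx_{n+1}\ldots$ carries the product topology (with $\mathcal A$ discrete), and the shift operator $T_{\mathcal A}$ acts on it by $(T_{\mathcal A}{\bf x})_n = x_{n+1}$. A subshift over $\mathcal A$ is a non-empty closed subset $X\subset\mathcal A^{\mathbb Z}$ with $T_{\mathcal A}(X)=X$. A factor of a (finite or biinfinite) word is a finite word occurring in it as a block of consecutive letters. The language $\mathcal L(X)\subset \mathcal A^*$ is the set of all factors of elements of $X$. The complexity function is $p_X(n) = $ the number of words of length $n$ in $\mathcal L(X)$, and the topological entropy of $X$ is $h_X=\lim_{n\to\infty}\frac{\log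 p_X(n)}{n}$. A monoid morphism $\sigma:\mathcal A^*\to\mathcal B^*$ is non-erasing if $\sigma(a)$ is not the empty word for any $a \in\mathcal A$, and letter-to-letter if $|\sigma(a)|=1$ for all $a\in\mathcal A$. The image subshift $\sigma(X)\subset\mathcal B^{\mathbb Z}$ is the set of all ${\bf y}\in\mathcal B^{\mathbb Z}$ such that every factor of ${\bf y}$ is a factor of $\sigma(w)$ for some $w\in\mathcal L(X)$. A non-erasing $\sigma$ acts on ${\bf x}\in\mathcal A^{\mathbb Z}$ by $\sigma({\bf x}) = \ldots y_{-1}y_0y_1\ldots$ where $y_1y_2\ldots = \sigma(x_1)\sigma(x_2)\ldots$ and $\ldots y_{-1}y_0 = \ldots\sigma(x_{-1})\sigma(x_0)$. The morphism $\sigma$ is recognizable in $X$ if: whenever ${\bf x},{\bf x'}\in X$ and ${\bf y}\in\mathcal B^{\mathbb Z}$ satisfy ${\bf y}=T_{\mathcal B}^k(\sigma({\bf x}))$ and ${\bf y}=T_{\mathcal B}^\ell(\sigma({\bf x'}))$ for integers $0\le k\le|\sigma(x_1)|-1$ and $0\le\ell\le|\sigma(x_1')|-1$, then ${\bf x}={\bf x'}$ and $k=\ell$. *)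

theory Defs
  imports "HOL-Analysis.Analysis" "HOL-Library.Sublist"
begin

section \<open>Subshifts\<close>

text \<open>
  Alphabets are finite non-empty carrier sets, so that one can quantify over them inside a formula.
  Biinfinite words over \<open>A\<close> are the functions \<open>x :: int \<Rightarrow> 'a\<close> with values in \<open>A\<close>.
\<close>

definition full_shift :: "'a set \<Rightarrow> (int \<Rightarrow> 'a) topology" where
  "full_shift A = product_topology (\<lambda>_. discrete_topology A) UNIV"

lemma topspace_full_shift: "topspace (full_shift A) = {x. range x \<subseteq> A}"
  by (auto simp: full_shift_def PiE_def)

definition shift :: "(int \<Rightarrow> 'a) \<Rightarrow> (int \<Rightarrow> 'a)" where
  "shift x = (\<lambda>n. x (n + 1))"

definition subshift :: "'a set \<Rightarrow> (int \<Rightarrow> 'a) set \<Rightarrow> bool" where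
  "subshift A X \<longleftrightarrow> X \<noteq> {} \<and> closedin (full_shift A) X \<and> shift ` X = X"

text \<open>The empty word is included, as \<open>[i..j] = []\<close> for \<open>j < i\<close>.\<close>

definition factors :: "(int \<Rightarrow> 'a) \<Rightarrow> 'a list set" where
  "factors x = {map x [i..j] | i j. True}"

definition language :: "(int \<Rightarrow> 'a) set \<Rightarrow> 'a list set" where
  "language X = (\<Union>x\<in>X. factors x)"

definition complexity :: "(int \<Rightarrow> 'a) set \<Rightarrow> nat \<Rightarrow> nat" where
  "complexity X n = card {w \<in> language X. length w = n}"

definition entropy :: "(int \<Rightarrow> 'a) set \<Rightarrow> real" where
  "entropy X = lim (\<lambda>n. ln (real (complexity X n)) / real n)"


section \<open>Morphisms of free monoids\<close>

definition monoid_morphism :: "'a set \<Rightarrow> 'b set \<Rightarrow> ('a list \<Rightarrow> 'b list) \<Rightarrow> bool" where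
  "monoid_morphism A B \<sigma> \<longleftrightarrow>
     (\<forall>w \<in> lists A. \<sigma> w \<in> lists B) \<and> \<sigma> [] = [] \<and>
     (\<forall>u \<in> lists A. \<forall>v \<in> lists A. \<sigma> (u @ v) = \<sigma> u @ \<sigma> v)"

definition non_erasing :: "'a set \<Rightarrow> ('a list \<Rightarrow> 'b list) \<Rightarrow> bool" where
  "non_erasing A \<sigma> \<longleftrightarrow> (\<forall>a\<in>A. \<sigma> [a] \<noteq> [])"

definition letter_to_letter :: "'a set \<Rightarrow> ('a list \<Rightarrow> 'b list) \<Rightarrow> bool" where
  "letter_to_letter A \<sigma> \<longleftrightarrow> (\<forall>a\<in>A. length (\<sigma> [a]) = 1)"

definition image_subshift ::
    "'b set \<Rightarrow> ('a list \<Rightarrow> 'b list) \<Rightarrow> (int \<Rightarrow> 'a) set \<Rightarrow> (int \<Rightarrow> 'b) set" where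
  "image_subshift B \<sigma> X =
     {y. range y \<subseteq> B \<and> (\<forall>u \<in> factors y. \<exists>w \<in> language X. sublist u (\<sigma> w))}"

text \<open>
  The action on biinfinite words: \<open>y\<^sub>1 y\<^sub>2 \<dots> = \<sigma>(x\<^sub>1) \<sigma>(x\<^sub>2) \<dots>\<close> to the right, and
  \<open>\<dots> y\<^sub>-\<^sub>1 y\<^sub>0 = \<dots> \<sigma>(x\<^sub>-\<^sub>1) \<sigma>(x\<^sub>0)\<close> to the left.  As \<open>\<sigma>\<close> is non-erasing, the letter \<open>y\<^sub>m\<close>
  already lies in \<open>\<sigma>(x\<^sub>1 \<dots> x\<^sub>m)\<close> for \<open>m \<ge> 1\<close>, respectively in \<open>\<sigma>(x\<^sub>m \<dots> x\<^sub>0)\<close> for \<open>m \<le> 0\<close>,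
  where it is counted from the right end.  The two lemmas below confirm both equations.
\<close>

definition image_word :: "('a list \<Rightarrow> 'b list) \<Rightarrow> (int \<Rightarrow> 'a) \<Rightarrow> (int \<Rightarrow> 'b)" where
  "image_word \<sigma> x = (\<lambda>m.
     if m \<ge> 1 then \<sigma> (map x [1..m]) ! nat (m - 1)
     else rev (\<sigma> (map x [m..0])) ! nat (- m))"

lemma length_morphism_ge:
  assumes "monoid_morphism A B \<sigma>" "non_erasing A \<sigma>" "w \<in> lists A"
  shows "length w \<le> length (\<sigma> w)"
  using assms(3)
proof (induction w)
  case (Cons a w)
  have "\<sigma> ([a] @ w) = \<sigma> [a] @ \<sigma> w"
    using assms(1) Cons.hyps unfolding monoid_morphism_def
    by (metis lists.Cons lists.Nil)
  moreover have "\<sigma> [a] \<noteq> []"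
    using assms(2) Cons.hyps unfolding non_erasing_def by blast
  then have "1 \<le> length (\<sigma> [a])"
    by (simp add: Suc_le_eq)
  ultimately show ?case using Cons.IH by simp
qed simp

lemma map_in_lists: "range x \<subseteq> A \<Longrightarrow> map x us \<in> lists A"
  by (induction us) auto

lemma morphism_map_append:
  assumes "monoid_morphism A B \<sigma>" "range x \<subseteq> A"
  shows "\<sigma> (map x us @ map x vs) = \<sigma> (map x us) @ \<sigma> (map x vs)"
proof -
  have "map x us \<in> lists A" "map x vs \<in> lists A" using assms(2) by (rule map_in_lists)+
  then show ?thesis using assms(1) unfolding monoid_morphism_def by blast
qed

lemma image_word_right:
  assumes "monoid_morphism A B \<sigma>" "non_erasing A \<sigma>" "range x \<subseteq> A"
  shows "map (image_word \<sigma> x) [1..int (length (\<sigma> (map x [1..n])))] = \<sigma> (map x [1..n])"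
proof (rule nth_equalityI)
  fix i assume "i < length (map (image_word \<sigma> x) [1..int (length (\<sigma> (map x [1..n])))])"
  then have i: "i < length (\<sigma> (map x [1..n]))" by simp
  have l: "i < length (\<sigma> (map x [1..1 + int i]))"
    using length_morphism_ge[OF assms(1,2) map_in_lists, of x "[1..1 + int i]"] assms(3) by (auto simp: Suc_le_eq nat_add_distrib)
  have "\<sigma> (map x [1..n]) ! i = \<sigma> (map x [1..1 + int i]) ! i"
  proof (cases "n \<le> 1 + int i")
    case True
    have "[1..1 + int i] = [1..n] @ [n + 1..1 + int i]" if "1 \<le> n"
      using upto_split2[OF that True] .
    moreover have "[1..n] = []" if "\<not> 1 \<le> n" using that by simp
    moreover have "\<sigma> [] = []" using assms(1) by (simp add: monoid_morphism_def)
    ultimately show ?thesis using i morphism_map_append[OF assms(1,3)]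
      by (cases "1 \<le> n") (auto simp: nth_append)
  next
    case False
    then have "[1..n] = [1..1 + int i] @ [1 + int i + 1..n]" by (intro upto_split2) auto
    then show ?thesis using l morphism_map_append[OF assms(1,3)]
      by (auto simp: nth_append)
  qed
  then show "map (image_word \<sigma> x) [1..int (length (\<sigma> (map x [1..n])))] ! i = \<sigma> (map x [1..n]) ! i"
    using i by (simp add: image_word_def)
qed simp

lemma image_word_left:
  assumes "monoid_morphism A B \<sigma>" "non_erasing A \<sigma>" "range x \<subseteq> A"
  shows "map (image_word \<sigma> x) [1 - int (length (\<sigma> (map x [n..0])))..0] = \<sigma> (map x [n..0])"
proof -
  define L where "L = length (\<sigma> (map x [n..0]))"
  have "map (image_word \<sigma> x) [1 - int L..0] ! i = \<sigma> (map x [n..0]) ! i" if "i < L" for i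
  proof -
    define j where "j = L - 1 - i"
    have j: "j < L" using that by (simp add: j_def)
    have idx: "1 - int L + int i = - int j" using that by (simp add: j_def)
    have l: "j < length (\<sigma> (map x [- int j..0]))"
      using length_morphism_ge[OF assms(1,2) map_in_lists, of x "[- int j..0]"] assms(3) by (auto simp: Suc_le_eq nat_add_distrib)
    have "rev (\<sigma> (map x [n..0])) ! j = rev (\<sigma> (map x [- int j..0])) ! j"
    proof (cases "- int j \<le> n")
      case True
      have "[- int j..0] = [- int j..n - 1] @ [n..0]" if "n \<le> 0"
        using upto_split1[of "- int j" n 0] True that by simp
      moreover have "n \<le> 0"
        using j assms(1) by (cases "n \<le> 0") (auto simp: L_def monoid_morphism_def)
      ultimately show ?thesis using j morphism_map_append[OF assms(1,3)]
        by (auto simp: nth_append L_def)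
    next
      case False
      then have "[n..0] = [n..- int j - 1] @ [- int j..0]" by (intro upto_split1) auto
      then show ?thesis using l morphism_map_append[OF assms(1,3)]
        by (auto simp: nth_append)
    qed
    moreover have "rev (\<sigma> (map x [n..0])) ! j = \<sigma> (map x [n..0]) ! i"
      using j that by (simp add: rev_nth L_def[symmetric] j_def)
    moreover have "image_word \<sigma> x (- int j) = rev (\<sigma> (map x [- int j..0])) ! j"
      by (simp add: image_word_def)
    ultimately show ?thesis using that idx by simp
  qed
  then show ?thesis by (intro nth_equalityI) (auto simp: L_def)
qed

definition recognizable_in ::
    "'b set \<Rightarrow> ('a list \<Rightarrow> 'b list) \<Rightarrow> (int \<Rightarrow> 'a) set \<Rightarrow> bool" where
  "recognizable_in B \<sigma> X \<longleftrightarrow>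
     (\<forall>x \<in> X. \<forall>x' \<in> X. \<forall>y. \<forall>k l :: nat.
        range y \<subseteq> B \<longrightarrow>
        k < length (\<sigma> [x 1]) \<longrightarrow> l < length (\<sigma> [x' 1]) \<longrightarrow>
        y = (shift ^^ k) (image_word \<sigma> x) \<longrightarrow> y = (shift ^^ l) (image_word \<sigma> x') \<longrightarrow>
        x = x' \<and> k = l)"

end

theory Submission
  imports Defs
begin

text \<open>
  A word of length \<open>d n\<close> in \<open>\<sigma>(X)\<close> is a window, at one of boundedly many offsets, of the image of
  a word of length \<open>n + O(1)\<close> in the language of \<open>X\<close>, provided that every letter has an image of
  length at least \<open>d\<close>.  Hence the entropy of \<open>\<sigma>(X)\<close> is at most that of \<open>X\<close> divided by \<open>d\<close>.
  The case \<open>d = 1\<close> is (1).  For (3), take the full shift on two letters and insert a third letter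
  after each letter: the marker makes the morphism recognizable, and \<open>d = 2\<close>.

  In (2), recognizability says that the letterwise action on \<open>X\<close> is injective.  By compactness
  its inverse is determined by windows of some radius \<open>N\<close>, so that \<open>p\<^sub>X(n) \<le> p\<^sub>Y(n + 2 N)\<close>.
\<close>

section \<open>Convergence of subadditive averages\<close>

text \<open>Fekete's argument: the limit is the infimum of \<open>a n / real n\<close> over
  \<open>n \<ge> 1\<close>. Splitting off copies of a fixed \<open>m\<close> gives
  \<open>a n \<le> real (n div m) * a m + a (n mod m)\<close>, so the quotient at \<open>n\<close>
  exceeds the one at \<open>m\<close> by at most a constant over \<open>n\<close>.\<close>

lemma fekete_convergent:
  fixes a :: "nat \<Rightarrow> real"
  assumes sub: "\<And>m n. a (m + n) \<le> a m + a n" and nonneg: "\<And>n. 0 \<le> a n"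
  shows "convergent (\<lambda>n. a n / real n)"
proof -
  define S where "S = (\<lambda>n. a n / real n) ` {1..}"
  define L where "L = Inf S"
  have bdd: "bdd_below S"
    unfolding S_def by (rule bdd_belowI[of _ 0]) (use nonneg in auto)
  have lower: "L \<le> a n / real n" if "n \<ge> 1" for n
    unfolding L_def by (rule cInf_lower[OF _ bdd]) (use that in \<open>auto simp: S_def\<close>)
  have mult: "a (q * m + r) \<le> real q * a m + a r" for q m r
  proof (induction q)
    case (Suc q)
    have "a (Suc q * m + r) = a (m + (q * m + r))" by (simp add: algebra_simps)
    also have "\<dots> \<le> a m + a (q * m + r)" by (rule sub)
    finally show ?case using Suc by (simp add: algebra_simps)
  qed simp
  have "(\<lambda>n. a n / real n) \<longlonglongrightarrow> L"
  proof (rule order_tendstoI)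
    fix c assume "c < L"
    show "\<forall>\<^sub>F n in sequentially. c < a n / real n"
      using eventually_ge_at_top[of 1]
      by eventually_elim (use lower \<open>c < L\<close> in force)
  next
    fix c assume "L < c"
    have "S \<noteq> {}" by (auto simp: S_def)
    with \<open>L < c\<close> obtain m where m: "m \<ge> 1" "a m / real m < c"
      unfolding L_def using cInf_lessD[of S c] by (auto simp: S_def)
    \<comment> \<open>One constant for all remainders \<open>n mod m\<close>: a sum of nonnegative
      terms dominates each term.\<close>
    define C where "C = (\<Sum>k<m. a k)"
    have bound: "a n \<le> real n * (a m / real m) + C" for n
    proof -
      have r: "n mod m < m" using m by simp
      have "a n \<le> real (n div m) * a m + a (n mod m)"
        using mult[of "n div m" m "n mod m"] by simp
      moreover have "a (n mod m) \<le> C"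
        unfolding C_def by (rule member_le_sum) (use nonneg r in auto)
      moreover have "real (n div m) * a m \<le> real n / real m * a m"
        by (rule mult_right_mono[OF of_nat_div_le_of_nat nonneg])
      ultimately show ?thesis by simp
    qed
    have "(\<lambda>n. a m / real m + C / real n) \<longlonglongrightarrow> a m / real m + 0"
      by (intro tendsto_intros lim_const_over_n)
    then have "\<forall>\<^sub>F n in sequentially. a m / real m + C / real n < c"
      using m by (intro order_tendstoD) auto
    then show "\<forall>\<^sub>F n in sequentially. a n / real n < c"
      using eventually_ge_at_top[of 1]
    proof eventually_elim
      case (elim n)
      have "a n / real n \<le> (real n * (a m / real m) + C) / real n"
        by (rule divide_right_mono[OF bound]) simp
      also have "\<dots> = a m / real m + C / real n"
        using elim by (simp add: add_divide_distrib)
      finally show ?case using elim by simp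
    qed
  qed
  then show ?thesis by (rule convergentI)
qed

section \<open>Windows and the language\<close>

text \<open>Start and length replace the end points of \<open>[i..j]\<close>, so that splitting and
  indexing need no case distinction for empty intervals.\<close>

definition block :: "(int \<Rightarrow> 'a) \<Rightarrow> int \<Rightarrow> nat \<Rightarrow> 'a list" where
  "block x i n = map (\<lambda>k. x (i + int k)) [0..<n]"

lemma length_block [simp]: "length (block x i n) = n"
  by (simp add: block_def)

lemma nth_block [simp]: "k < n \<Longrightarrow> block x i n ! k = x (i + int k)"
  by (simp add: block_def)

lemma map_upto_eq_block: "map x [i..j] = block x i (nat (j - i + 1))"
  by (rule nth_equalityI) auto

lemma block_add: "block x i (m + n) = block x i m @ block x (i + int m) n"
  by (rule nth_equalityI) (auto simp: nth_append algebra_simps)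

lemma block_in_lists: "range x \<subseteq> A \<Longrightarrow> block x i n \<in> lists A"
  unfolding block_def by (induction n) auto

lemma factors_eq_blocks: "factors x = {block x i n | i n. True}"
proof -
  have "block x i n = map x [i..i + int n - 1]" for i n
    by (simp add: map_upto_eq_block)
  then show ?thesis unfolding factors_def by (fastforce simp: map_upto_eq_block)
qed

lemma language_length_eq_blocks:
  "{w \<in> language X. length w = n} = {block x i n | x i. x \<in> X}"
  by (fastforce simp: language_def factors_eq_blocks)

lemma block_in_language: "x \<in> X \<Longrightarrow> block x i n \<in> language X"
  using language_length_eq_blocks[of X n] by auto

lemma in_languageE:
  assumes "w \<in> language X"
  obtains x i where "x \<in> X" "w = block x i (length w)"
proof -
  have "w \<in> {w' \<in> language X. length w' = length w}" using assms by simp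
  then show thesis using that unfolding language_length_eq_blocks by blast
qed

lemma language_in_lists:
  assumes "X \<subseteq> {x. range x \<subseteq> A}" "w \<in> language X"
  shows "w \<in> lists A"
  using assms(2) by (rule in_languageE) (use assms(1) block_in_lists in \<open>metis mem_Collect_eq subsetD\<close>)

lemma finite_language_length:
  assumes "finite A" "X \<subseteq> {x. range x \<subseteq> A}"
  shows "finite {w \<in> language X. length w = n}"
  by (rule finite_subset[OF _ finite_lists_length_eq[OF assms(1), of n]])
     (use language_in_lists[OF assms(2)] in auto)

section \<open>Complexity and entropy\<close>

text \<open>Cutting a word after \<open>m\<close> letters leaves two words of the language, and
  these determine the word.\<close>

lemma complexity_add_le:
  assumes "finite A" "X \<subseteq> {x. range x \<subseteq> A}"
  shows "complexity X (m + n) \<le> complexity X m * complexity X n"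
proof -
  let ?L = "\<lambda>n. {w \<in> language X. length w = n}"
  have fin: "finite (?L n)" for n by (rule finite_language_length[OF assms])
  have "?L (m + n) \<subseteq> (\<lambda>(u, v). u @ v) ` (?L m \<times> ?L n)"
  proof
    fix w assume "w \<in> ?L (m + n)"
    then obtain x i where "x \<in> X" "w = block x i m @ block x (i + int m) n"
      unfolding language_length_eq_blocks by (auto simp: block_add)
    then show "w \<in> (\<lambda>(u, v). u @ v) ` (?L m \<times> ?L n)"
      by (auto simp: block_in_language image_iff)
  qed
  then have "card (?L (m + n)) \<le> card (?L m \<times> ?L n)"
    by (rule surj_card_le[rotated]) (use fin in auto)
  then show ?thesis by (simp add: complexity_def card_cartesian_product)
qed

text \<open>The convention \<open>ln 0 = 0\<close> covers the value 0, since \<open>ln\<close> is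
  nonnegative on positive naturals. Counts thus need not be shown positive before logarithms are
  taken.\<close>

lemma ln_real_nat_mono: "m \<le> n \<Longrightarrow> ln (real m) \<le> ln (real n)"
  by (cases "m = 0"; cases "n = 0") auto

text \<open>Only an inequality: if just one factor is 0, the left side is \<open>ln 0 = 0\<close>
  while the right side may be positive.\<close>

lemma ln_real_mult_le: "ln (real (m * n)) \<le> ln (real m) + ln (real n)"
  by (cases "m = 0"; cases "n = 0") (auto simp: ln_mult)

lemma ln_complexity_add_le:
  assumes "finite A" "X \<subseteq> {x. range x \<subseteq> A}"
  shows "ln (real (complexity X (m + n))) \<le> ln (real (complexity X m)) + ln (real (complexity X n))"
  using ln_real_nat_mono[OF complexity_add_le[OF assms]] ln_real_mult_le order_trans by blast

text \<open>\<open>entropy\<close> is defined by \<open>lim\<close>, which says something only for a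
  convergent sequence; subadditivity of the logarithm of the complexity provides
  convergence.\<close>

lemma entropy_LIMSEQ:
  assumes "finite A" "X \<subseteq> {x. range x \<subseteq> A}"
  shows "(\<lambda>n. ln (real (complexity X n)) / real n) \<longlonglongrightarrow> entropy X"
proof -
  have nonneg: "0 \<le> ln (real k)" for k :: nat
    by (cases "k = 0") auto
  have "convergent (\<lambda>n. ln (real (complexity X n)) / real n)"
    by (rule fekete_convergent[OF ln_complexity_add_le[OF assms] nonneg])
  then show ?thesis by (simp add: entropy_def convergent_LIMSEQ_iff)
qed

text \<open>Take logarithms and divide by \<open>d * n\<close>. The factor \<open>M\<close> and the
  \<open>N\<close> extra letters contribute a constant \<open>C\<close> that vanishes in the limit,
  and the left side runs through a subsequence of the quotients defining the entropy of
  \<open>Z\<close>.\<close>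

lemma entropy_mult_le:
  assumes X: "finite A" "X \<subseteq> {x. range x \<subseteq> A}" and Z: "finite B" "Z \<subseteq> {x. range x \<subseteq> B}"
    and "0 < d" and le: "\<And>n. 0 < n \<Longrightarrow> complexity Z (d * n) \<le> M * complexity X (n + N)"
  shows "entropy Z \<le> entropy X / real d"
proof -
  define C where "C = ln (real M) + ln (real (complexity X N))"
  have "(\<lambda>n. (C / real n + ln (real (complexity X n)) / real n) / real d)
          \<longlonglongrightarrow> (0 + entropy X) / real d"
    using \<open>0 < d\<close> by (intro tendsto_intros lim_const_over_n entropy_LIMSEQ[OF X]) auto
  moreover have "(\<lambda>n. ln (real (complexity Z (d * n))) / real (d * n)) \<longlonglongrightarrow> entropy Z"
    using LIMSEQ_subseq_LIMSEQ[OF entropy_LIMSEQ[OF Z], of "\<lambda>n. d * n"] \<open>0 < d\<close>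
    by (simp add: o_def strict_mono_def)
  moreover have "\<forall>\<^sub>F n in sequentially. ln (real (complexity Z (d * n))) / real (d * n)
      \<le> (C / real n + ln (real (complexity X n)) / real n) / real d"
    using eventually_gt_at_top[of 0]
  proof eventually_elim
    case (elim n)
    have "ln (real (complexity Z (d * n))) \<le> ln (real M) + ln (real (complexity X (n + N)))"
      using ln_real_nat_mono[OF le[OF elim]] ln_real_mult_le order_trans by blast
    also have "\<dots> \<le> C + ln (real (complexity X n))"
      using ln_complexity_add_le[OF X, of n N] by (simp add: C_def)
    finally have "ln (real (complexity Z (d * n))) / real (d * n)
        \<le> (C + ln (real (complexity X n))) / real (d * n)"
      by (rule divide_right_mono) simp
    then show ?case by (simp add: add_divide_distrib mult.commute)
  qed
  ultimately have "entropy Z \<le> (0 + entropy X) / real d"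
    by (intro tendsto_le[of sequentially]) auto
  then show ?thesis by simp
qed

section \<open>Translates, and positions in image words\<close>

lemma subshift_subset: "subshift A X \<Longrightarrow> X \<subseteq> {x. range x \<subseteq> A}"
  using closedin_subset topspace_full_shift unfolding subshift_def by metis

text \<open>Of the equality \<open>shift\<close> with \<open>X\<close> as fixed set, one inclusion
  gives the steps to larger \<open>i\<close>; the other provides preimages for the steps to smaller
  \<open>i\<close>.\<close>

lemma subshift_translate:
  assumes "subshift A X" "x \<in> X"
  shows "(\<lambda>n. x (n + i)) \<in> X"
proof (induction i rule: int_induct[where k = 0])
  case base
  show ?case using assms by simp
next
  case (step1 i)
  have "shift (\<lambda>n. x (n + i)) \<in> X"
    using assms step1 unfolding subshift_def by blast
  then show ?case by (simp add: shift_def algebra_simps)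
next
  case (step2 i)
  then obtain z where z: "z \<in> X" "(\<lambda>n. x (n + i)) = shift z"
    using assms unfolding subshift_def by blast
  have "x (n + (i - 1)) = z n" for n
    using fun_cong[OF z(2), of "n - 1"] by (simp add: shift_def algebra_simps)
  then show ?case using z by (simp add: fun_eq_iff)
qed

lemma image_subshift_subset: "image_subshift B \<sigma> X \<subseteq> {y. range y \<subseteq> B}"
  by (auto simp: image_subshift_def)

lemma morphism_append:
  assumes "monoid_morphism A B \<sigma>" "u \<in> lists A" "v \<in> lists A"
  shows "\<sigma> (u @ v) = \<sigma> u @ \<sigma> v"
  using assms unfolding monoid_morphism_def by blast

lemma morphism_Cons:
  assumes "monoid_morphism A B \<sigma>" "a \<in> A" "v \<in> lists A"
  shows "\<sigma> (a # v) = \<sigma> [a] @ \<sigma> v"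
  using morphism_append[OF assms(1), of "[a]" v] assms(2,3) by simp

lemma length_morphism_ge_mult:
  assumes "monoid_morphism A B \<sigma>" "\<And>a. a \<in> A \<Longrightarrow> d \<le> length (\<sigma> [a])" "w \<in> lists A"
  shows "d * length w \<le> length (\<sigma> w)"
  using assms(3)
proof (induction w)
  case (Cons a w)
  then show ?case using morphism_Cons[OF assms(1), of a w] assms(2)[of a] by simp
qed simp

text \<open>Finds the letter whose image contains position \<open>k\<close>. The offset of
  \<open>k\<close> inside that image is what stays bounded when windows of images are
  counted.\<close>

lemma morphism_position:
  assumes "monoid_morphism A B \<sigma>" "w \<in> lists A" "k < length (\<sigma> w)"
  obtains u a v where "w = u @ a # v" "length (\<sigma> u) \<le> k" "k < length (\<sigma> u) + length (\<sigma> [a])"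
proof -
  have nil: "\<sigma> [] = []" using assms(1) by (simp add: monoid_morphism_def)
  have "\<exists>u a v. w = u @ a # v \<and> length (\<sigma> u) \<le> k \<and> k < length (\<sigma> u) + length (\<sigma> [a])"
    using assms(2,3)
  proof (induction w arbitrary: k)
    case Nil
    then show ?case by (simp add: nil)
  next
    case (Cons b w)
    show ?case
    proof (cases "k < length (\<sigma> [b])")
      case True
      then have "b # w = [] @ b # w \<and> length (\<sigma> []) \<le> k \<and> k < length (\<sigma> []) + length (\<sigma> [b])"
        by (simp add: nil)
      then show ?thesis by blast
    next
      case False
      then have "k - length (\<sigma> [b]) < length (\<sigma> w)"
        using Cons morphism_Cons[OF assms(1), of b w] by auto
      from Cons.IH[OF this] obtain u a v where uav: "w = u @ a # v"
        "length (\<sigma> u) \<le> k - length (\<sigma> [b])"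
        "k - length (\<sigma> [b]) < length (\<sigma> u) + length (\<sigma> [a])" by blast
      have "\<sigma> (b # u) = \<sigma> [b] @ \<sigma> u"
        using Cons.hyps uav(1) by (intro morphism_Cons[OF assms(1)]) auto
      then have "b # w = (b # u) @ a # v \<and> length (\<sigma> (b # u)) \<le> k \<and>
          k < length (\<sigma> (b # u)) + length (\<sigma> [a])"
        using uav False by auto
      then show ?thesis by blast
    qed
  qed
  then show thesis using that by blast
qed

section \<open>Upper bound for the entropy of the image\<close>

text \<open>\<open>u\<close> occurs in \<open>\<sigma> v\<close> for a factor \<open>v\<close> of
  some \<open>x\<close> in \<open>X\<close>. Discard the letters of \<open>v\<close> whose images
  end before the occurrence; it then starts inside the image of the next letter, at an offset below
  \<open>M\<close>. Reading \<open>m\<close> letters of \<open>x\<close> from there gives an image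
  of length at least \<open>d * m\<close>, long enough to contain \<open>u\<close>.\<close>

lemma image_language_cover:
  assumes \<sigma>: "monoid_morphism A B \<sigma>" and X: "X \<subseteq> {x. range x \<subseteq> A}"
    and d: "\<And>a. a \<in> A \<Longrightarrow> d \<le> length (\<sigma> [a])" and M: "\<And>a. a \<in> A \<Longrightarrow> length (\<sigma> [a]) \<le> M"
    and u: "u \<in> language (image_subshift B \<sigma> X)" "u \<noteq> []"
    and m: "length u + M \<le> d * m"
  shows "\<exists>k<M. \<exists>w \<in> language X. length w = m \<and> u = take (length u) (drop k (\<sigma> w))"
proof -
  obtain y where "y \<in> image_subshift B \<sigma> X" "u \<in> factors y"
    using u(1) by (auto simp: language_def)
  then obtain v where v: "v \<in> language X" "sublist u (\<sigma> v)"
    unfolding image_subshift_def by blast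
  then obtain p s where pus: "\<sigma> v = p @ u @ s" by (auto simp: sublist_def)
  obtain x i where xi: "x \<in> X" "v = block x i (length v)" using v(1) by (rule in_languageE)
  have range: "range x \<subseteq> A" using xi(1) X by blast
  note lists = block_in_lists[OF range]
  have vA: "v \<in> lists A" using xi(2) lists by metis
  \<comment> \<open>As \<open>u\<close> is non-empty, its first letter sits at position
    \<open>length p\<close> of \<open>\<sigma> v\<close>.\<close>
  have "length p < length (\<sigma> v)" using pus u(2) by simp
  from morphism_position[OF \<sigma> vA this] obtain v1 a v2 where
    v12: "v = v1 @ a # v2" "length (\<sigma> v1) \<le> length p"
      "length p < length (\<sigma> v1) + length (\<sigma> [a])" by blast
  define k where "k = length p - length (\<sigma> v1)"
  define w where "w = block x (i + int (length v1)) m"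
  define z where "z = block x (i + int (length v1) + int m) (length (a # v2))"
  \<comment> \<open>\<open>w\<close> may end before or after \<open>v\<close> does. Both are
    therefore prolonged along \<open>x\<close> to a common end, where their images can be
    compared.\<close>
  have wz: "w @ z = a # v2 @ block x (i + int (length v)) m"
  proof -
    have "v @ block x (i + int (length v)) m = block x i (length v + m)"
      by (simp only: block_add xi(2)[symmetric])
    also have "\<dots> = block x i (length v1 + (m + length (a # v2)))"
      using v12(1) by (simp add: algebra_simps)
    also have "\<dots> = block x i (length v1) @ w @ z"
      by (simp only: block_add w_def z_def)
    finally show ?thesis using v12(1) by simp
  qed
  have vlists: "v1 \<in> lists A" "a \<in> A" "v2 \<in> lists A" using vA v12(1) by auto
  have wzlists: "w \<in> lists A" "z \<in> lists A" unfolding w_def z_def by (rule lists)+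
  have "\<sigma> v1 @ \<sigma> w @ \<sigma> z = \<sigma> (v1 @ w @ z)"
    using vlists wzlists by (simp add: morphism_append[OF \<sigma>])
  also have "\<dots> = \<sigma> (v @ block x (i + int (length v)) m)"
    by (simp add: wz v12(1))
  also have "\<dots> = p @ u @ s @ \<sigma> (block x (i + int (length v)) m)"
    by (simp add: morphism_append[OF \<sigma> vA lists] pus)
  finally have eq: "\<sigma> v1 @ \<sigma> w @ \<sigma> z = p @ u @ s @ \<sigma> (block x (i + int (length v)) m)" .
  have "k < M" using v12 M[OF vlists(2)] by (auto simp: k_def)
  have len: "length u + M \<le> length (\<sigma> w)"
    using length_morphism_ge_mult[OF \<sigma> d wzlists(1)] m by (simp add: w_def)
  have "u = take (length u) (drop (length p) (\<sigma> v1 @ \<sigma> w @ \<sigma> z))"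
    unfolding eq by simp
  \<comment> \<open>By \<open>len\<close> and \<open>k < M\<close> the window ends inside
    \<open>\<sigma> w\<close>, so \<open>\<sigma> z\<close> drops out.\<close>
  also have "\<dots> = take (length u) (drop k (\<sigma> w))"
    using v12(2) len \<open>k < M\<close> by (simp add: k_def)
  finally have "length w = m \<and> u = take (length u) (drop k (\<sigma> w))"
    by (simp add: w_def)
  moreover have "w \<in> language X"
    unfolding w_def by (rule block_in_language[OF xi(1)])
  ultimately show ?thesis using \<open>k < M\<close> by blast
qed

text \<open>A word of length \<open>d * n\<close> is given by an offset below \<open>M\<close> and a
  word of length \<open>n + M\<close>, hence by at most \<open>M * complexity X (n + M)\<close>
  choices.\<close>

lemma entropy_image_subshift_le:
  assumes fin: "finite A" "finite B" and \<sigma>: "monoid_morphism A B \<sigma>" and X: "X \<subseteq> {x. range x \<subseteq> A}"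
    and d: "0 < d" "\<And>a. a \<in> A \<Longrightarrow> d \<le> length (\<sigma> [a])"
  shows "entropy (image_subshift B \<sigma> X) \<le> entropy X / real d"
proof -
  let ?Y = "image_subshift B \<sigma> X"
  define M where "M = (\<Sum>a\<in>A. length (\<sigma> [a]))"
  have M: "length (\<sigma> [a]) \<le> M" if "a \<in> A" for a
    unfolding M_def by (rule member_le_sum) (use that fin in auto)
  show ?thesis
  proof (rule entropy_mult_le[OF fin(1) X fin(2) image_subshift_subset d(1)])
    fix n :: nat assume "0 < n"
    let ?W = "{w \<in> language X. length w = n + M}"
    have "{u \<in> language ?Y. length u = d * n}
        \<subseteq> (\<lambda>(k, w). take (d * n) (drop k (\<sigma> w))) ` ({..<M} \<times> ?W)"
    proof
      fix u assume "u \<in> {u \<in> language ?Y. length u = d * n}"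
      then have u: "u \<in> language ?Y" "length u = d * n" by auto
      \<comment> \<open>The length bound is \<open>M \<le> d * M\<close>, which holds as
        \<open>d\<close> is positive.\<close>
      have "u \<noteq> []" "length u + M \<le> d * (n + M)"
        using u(2) \<open>0 < n\<close> \<open>0 < d\<close> by (auto simp: algebra_simps)
      from image_language_cover[OF \<sigma> X d(2) M u(1) this] u(2)
      show "u \<in> (\<lambda>(k, w). take (d * n) (drop k (\<sigma> w))) ` ({..<M} \<times> ?W)"
        by (auto simp: image_iff)
    qed
    then have "card {u \<in> language ?Y. length u = d * n} \<le> card ({..<M} \<times> ?W)"
      by (rule surj_card_le[rotated]) (use finite_language_length[OF fin(1) X] in auto)
    then show "complexity ?Y (d * n) \<le> M * complexity X (n + M)"
      by (simp add: complexity_def card_cartesian_product)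
  qed
qed


section \<open>Letter-to-letter morphisms\<close>

text \<open>Reduces the morphism to a function on letters, the form needed for the compactness
  argument.\<close>

lemma letter_to_letter_map:
  assumes "monoid_morphism A B \<sigma>" "letter_to_letter A \<sigma>" "w \<in> lists A"
  shows "\<sigma> w = map (\<lambda>a. hd (\<sigma> [a])) w"
  using assms(3)
proof (induction w)
  case Nil
  then show ?case using assms(1) by (simp add: monoid_morphism_def)
next
  case (Cons a w)
  then have "length (\<sigma> [a]) = 1" using assms(2) by (simp add: letter_to_letter_def)
  then have "\<sigma> [a] = [hd (\<sigma> [a])]" by (cases "\<sigma> [a]") auto
  then show ?case using morphism_Cons[OF assms(1), of a w] Cons by simp
qed

lemma letter_to_letter_image_word:
  assumes "monoid_morphism A B \<sigma>" "letter_to_letter A \<sigma>" "range x \<subseteq> A"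
  shows "image_word \<sigma> x = (\<lambda>n. hd (\<sigma> [x n]))"
  unfolding image_word_def
  by (rule ext) (simp add: letter_to_letter_map[OF assms(1,2) map_in_lists[OF assms(3)]] rev_nth)

text \<open>Each window of the image is \<open>\<sigma>\<close> of the same window of
  \<open>x\<close>.\<close>

lemma letter_to_letter_image_in:
  assumes \<sigma>: "monoid_morphism A B \<sigma>" "letter_to_letter A \<sigma>" and x: "range x \<subseteq> A" "x \<in> X"
  shows "(\<lambda>n. hd (\<sigma> [x n])) \<in> image_subshift B \<sigma> X"
  unfolding image_subshift_def mem_Collect_eq
proof (intro conjI ballI)
  show "range (\<lambda>n. hd (\<sigma> [x n])) \<subseteq> B"
  proof (rule image_subsetI)
    fix n
    have "[x n] \<in> lists A" using x by auto
    then have "\<sigma> [x n] \<in> lists B" "\<sigma> [x n] \<noteq> []"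
      using \<sigma> by (force simp: monoid_morphism_def letter_to_letter_def)+
    then show "hd (\<sigma> [x n]) \<in> B" by (cases "\<sigma> [x n]") auto
  qed
next
  fix u assume "u \<in> factors (\<lambda>n. hd (\<sigma> [x n]))"
  then obtain i n where "u = block (\<lambda>n. hd (\<sigma> [x n])) i n"
    unfolding factors_eq_blocks by blast
  then have "u = map (\<lambda>a. hd (\<sigma> [a])) (block x i n)" by (simp add: block_def)
  then have "u = \<sigma> (block x i n)"
    using letter_to_letter_map[OF \<sigma> block_in_lists[OF x(1)]] by simp
  then show "\<exists>w\<in>language X. sublist u (\<sigma> w)"
    using block_in_language[OF x(2)] by blast
qed

section \<open>Compactness and the local inverse\<close>

lemma compact_space_full_shift: "finite A \<Longrightarrow> compact_space (full_shift A)"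
  by (auto simp: full_shift_def compact_space_product_topology compact_space_discrete_topology)

text \<open>The condition is the preimage, under a coordinate projection, of a subset of a discrete
  space. An arbitrary \<open>R\<close> covers both equality of images and inequality of
  letters.\<close>

lemma closedin_full_shift_prod:
  "closedin (prod_topology (full_shift A) (full_shift A))
     {p \<in> topspace (prod_topology (full_shift A) (full_shift A)). R (fst p i) (snd p i)}"
proof -
  let ?P = "prod_topology (full_shift A) (full_shift A)"
  let ?D = "prod_topology (discrete_topology A) (discrete_topology A)"
  have coord: "continuous_map (full_shift A) (discrete_topology A) (\<lambda>x. x i)"
    unfolding full_shift_def by (rule continuous_map_product_projection) simp
  have "continuous_map ?P ?D (\<lambda>p. (fst p i, snd p i))"
    using continuous_map_compose[OF continuous_map_fst coord]
      continuous_map_compose[OF continuous_map_snd coord]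
    by (intro continuous_map_pairedI) (auto simp: o_def)
  moreover have "closedin ?D {q \<in> A \<times> A. R (fst q) (snd q)}"
    by (auto simp flip: prod_topology_discrete_topology)
  ultimately have "closedin ?P {p \<in> topspace ?P. (fst p i, snd p i) \<in> {q \<in> A \<times> A. R (fst q) (snd q)}}"
    by (rule closedin_continuous_map_preimage)
  moreover have "{p \<in> topspace ?P. (fst p i, snd p i) \<in> {q \<in> A \<times> A. R (fst q) (snd q)}}
      = {p \<in> topspace ?P. R (fst p i) (snd p i)}"
    by (auto simp: topspace_full_shift)
  ultimately show ?thesis by simp
qed

text \<open>If no radius worked, compactness would give one pair that violates every radius at once:
  two points with equal images but different letters at 0, against injectivity.\<close>

lemma injective_block_code_local_inverse:
  assumes "finite A" "closedin (full_shift A) X" "inj_on (\<lambda>x n. t (x n)) X"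
  obtains N :: nat where
    "\<And>x x'. \<lbrakk>x \<in> X; x' \<in> X; \<And>i. \<bar>i\<bar> \<le> int N \<Longrightarrow> t (x i) = t (x' i)\<rbrakk> \<Longrightarrow> x 0 = x' 0"
proof -
  let ?P = "prod_topology (full_shift A) (full_shift A)"
  define E where "E i = {p \<in> topspace ?P. t (fst p i) = t (snd p i)}" for i
  \<comment> \<open>\<open>C N\<close> collects the counterexamples to radius \<open>N\<close>;
    these closed sets decrease with \<open>N\<close>.\<close>
  define C where "C N = (X \<times> X) \<inter> {p \<in> topspace ?P. fst p 0 \<noteq> snd p 0} \<inter> (\<Inter>i\<in>{- int N..int N}. E i)"
    for N :: nat
  have "\<exists>N. C N = {}"
  proof (rule ccontr)
    assume ne: "\<nexists>N. C N = {}"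
    have "closedin ?P (C N)" for N
      unfolding C_def E_def
      by (intro closedin_Int closedin_INT closedin_full_shift_prod)
         (use assms(2) in \<open>auto simp: closedin_prod_Times_iff\<close>)
    moreover have "decseq C"
      unfolding decseq_def C_def by fastforce
    moreover have "compact_space ?P"
      using compact_space_full_shift[OF assms(1)] by (simp add: compact_space_prod_topology)
    ultimately have "(\<Inter>N. C N) \<noteq> {}"
      using ne by (intro compact_space_imp_nest) auto
    then obtain x x' where p: "\<And>N. (x, x') \<in> C N" by auto
    have "t (x i) = t (x' i)" for i
      using p[of "nat \<bar>i\<bar>"] by (force simp: C_def E_def)
    then have "x = x'"
      using assms(3) p[of 0] by (auto simp: C_def inj_on_def)
    then show False using p[of 0] by (simp add: C_def)
  qed
  then obtain N where N: "C N = {}" ..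
  show thesis
  proof (rule that[of N])
    fix x x' assume *: "x \<in> X" "x' \<in> X" "\<And>i. \<bar>i\<bar> \<le> int N \<Longrightarrow> t (x i) = t (x' i)"
    then have "(x, x') \<in> topspace ?P"
      using closedin_subset[OF assms(2)] by auto
    then show "x 0 = x' 0" using N * by (auto simp: C_def E_def abs_le_iff)
  qed
qed

text \<open>A word of length \<open>n\<close> is determined by the image of its window enlarged by
  \<open>N\<close> on both sides, so the complexity of \<open>X\<close> at \<open>n\<close> is at
  most that of \<open>Y\<close> at \<open>n + 2 * N\<close>.\<close>

lemma entropy_le_of_injective_block_code:
  assumes A: "finite A" "subshift A X" and B: "finite B" "Y \<subseteq> {y. range y \<subseteq> B}"
    and inj: "inj_on (\<lambda>x n. t (x n)) X" and Y: "\<And>x. x \<in> X \<Longrightarrow> (\<lambda>n. t (x n)) \<in> Y"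
  shows "entropy X \<le> entropy Y"
proof -
  have XA: "X \<subseteq> {x. range x \<subseteq> A}" by (rule subshift_subset[OF A(2)])
  have "closedin (full_shift A) X" using A(2) by (simp add: subshift_def)
  from injective_block_code_local_inverse[OF A(1) this inj] obtain N :: nat where
    N: "\<And>x x'. \<lbrakk>x \<in> X; x' \<in> X; \<And>i. \<bar>i\<bar> \<le> int N \<Longrightarrow> t (x i) = t (x' i)\<rbrakk> \<Longrightarrow> x 0 = x' 0"
    by blast
  \<comment> \<open>The factors 1 fit the general growth comparison with \<open>d = 1\<close> and
    \<open>M = 1\<close>.\<close>
  have "complexity X (1 * n) \<le> 1 * complexity Y (n + 2 * N)" for n
  proof -
    let ?L = "{w \<in> language X. length w = n}"
    have "\<forall>w\<in>?L. \<exists>x. x \<in> X \<and> w = block x 0 n"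
    proof
      fix w assume "w \<in> ?L"
      then obtain x i where xi: "x \<in> X" "w = block x i n"
        unfolding language_length_eq_blocks by blast
      then have "w = block (\<lambda>k. x (k + i)) 0 n" by (simp add: block_def add.commute)
      then show "\<exists>x. x \<in> X \<and> w = block x 0 n"
        using subshift_translate[OF A(2) xi(1)] by blast
    qed
    then obtain f where f: "\<And>w. w \<in> ?L \<Longrightarrow> f w \<in> X \<and> w = block (f w) 0 n" by metis
    \<comment> \<open>The image window from \<open>- int N\<close> to \<open>int (n + N) - 1\<close>
      of a chosen point that shows \<open>w\<close> at position 0.\<close>
    let ?g = "\<lambda>w. block (\<lambda>k. t (f w k)) (- int N) (n + 2 * N)"
    have "inj_on ?g ?L"
    proof (rule inj_onI)
      fix v w assume vw: "v \<in> ?L" "w \<in> ?L" "?g v = ?g w"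
      have "f v (int k) = f w (int k)" if "k < n" for k
      proof -
        have "t (f v (j + int k)) = t (f w (j + int k))" if j: "\<bar>j\<bar> \<le> int N" for j
        proof -
          have "0 \<le> j + int k + int N" "nat (j + int k + int N) < n + 2 * N" using j \<open>k < n\<close> by auto
          with arg_cong[OF vw(3), of "\<lambda>u. u ! nat (j + int k + int N)"]
          show ?thesis by simp
        qed
        \<comment> \<open>The local inverse recovers only the letter at 0, hence the translates by
          \<open>int k\<close>.\<close>
        then show ?thesis
          using N[OF subshift_translate[OF A(2), of "f v" "int k"] subshift_translate[OF A(2), of "f w" "int k"]]
            f[OF vw(1)] f[OF vw(2)] by simp
      qed
      then have "block (f v) 0 n = block (f w) 0 n" by (simp add: block_def)
      then show "v = w" using f[OF vw(1)] f[OF vw(2)] by simp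
    qed
    moreover have "?g ` ?L \<subseteq> {w \<in> language Y. length w = n + 2 * N}"
      using f Y by (auto intro: block_in_language)
    ultimately show ?thesis
      unfolding complexity_def mult_1 by (rule card_inj_on_le) (rule finite_language_length[OF B])
  qed
  from entropy_mult_le[OF B A(1) XA _ this] show ?thesis by simp
qed

text \<open>Recognizability with both offsets equal to 0, the only ones available when letter images
  have length 1.\<close>

lemma recognizable_letter_to_letter_inj:
  assumes "monoid_morphism A B \<sigma>" "letter_to_letter A \<sigma>" "X \<subseteq> {x. range x \<subseteq> A}"
    "recognizable_in B \<sigma> X"
  shows "inj_on (\<lambda>x n. hd (\<sigma> [x n])) X"
proof (rule inj_onI)
  fix x x' assume x: "x \<in> X" "x' \<in> X" "(\<lambda>n. hd (\<sigma> [x n])) = (\<lambda>n. hd (\<sigma> [x' n]))"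
  have range: "range x \<subseteq> A" "range x' \<subseteq> A" using x assms(3) by auto
  let ?y = "\<lambda>n. hd (\<sigma> [x n])"
  have "range ?y \<subseteq> B"
    using letter_to_letter_image_in[OF assms(1,2) range(1) x(1)] by (simp add: image_subshift_def)
  moreover have "?y = (shift ^^ 0) (image_word \<sigma> x)" "?y = (shift ^^ 0) (image_word \<sigma> x')"
    using letter_to_letter_image_word[OF assms(1,2)] range x(3) by simp_all
  moreover have "0 < length (\<sigma> [x 1])" "0 < length (\<sigma> [x' 1])"
    using assms(2) range by (auto simp: letter_to_letter_def range_subsetD)
  ultimately show "x = x'"
    using assms(4) x(1,2) unfolding recognizable_in_def by blast
qed

section \<open>The marker morphism\<close>

text \<open>The morphism for (3). With \<open>c\<close> outside the alphabet, the occurrences of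
  \<open>c\<close> reveal where the letter images begin and end.\<close>

definition pad :: "'a \<Rightarrow> 'a list \<Rightarrow> 'a list" where
  "pad c w = concat (map (\<lambda>a. [a, c]) w)"

lemma pad_simps [simp]: "pad c [] = []" "pad c (a # w) = a # c # pad c w"
  by (simp_all add: pad_def)

lemma length_pad [simp]: "length (pad c w) = 2 * length w"
  by (induction w) auto

lemma pad_append [simp]: "pad c (u @ v) = pad c u @ pad c v"
  by (simp add: pad_def)

lemma pad_nth: "k < 2 * length w \<Longrightarrow> pad c w ! k = (if even k then w ! (k div 2) else c)"
proof (induction w arbitrary: k)
  case (Cons a w)
  consider "k = 0" | "k = 1" | j where "k = Suc (Suc j)"
    by (metis One_nat_def not0_implies_Suc)
  then show ?case by cases (use Cons in auto)
qed simp

text \<open>The image of \<open>x n\<close> occupies the positions \<open>2 * n - 1\<close> and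
  \<open>2 * n\<close>, on both sides of the origin.\<close>

lemma image_word_pad: "image_word (pad c) x m = (if odd m then x ((m + 1) div 2) else c)"
proof (cases "m \<ge> 1")
  case True
  then obtain k where m: "m = int k + 1"
    by (metis add.commute nonneg_int_cases zle_iff_zadd)
  show ?thesis
  proof (cases "even k")
    case True
    then obtain j where "k = 2 * j" by (elim evenE)
    then show ?thesis unfolding image_word_def m by (simp add: pad_nth nat_mult_distrib)
  next
    case False
    then show ?thesis unfolding image_word_def m by (simp add: pad_nth)
  qed
next
  case False
  then have "m = - int (nat (- m))" by simp
  then obtain k where m: "m = - int k" by blast
  \<comment> \<open>The padded word has length \<open>2 * (k + 1)\<close>, so index \<open>k\<close>
    from the right is index \<open>k + 1\<close> from the left.\<close>
  have "rev (pad c (map x [m..0])) ! k = pad c (map x [m..0]) ! (k + 1)"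
    by (subst rev_nth) (auto simp: m nat_add_distrib)
  also have "\<dots> = (if odd k then map x [m..0] ! ((k + 1) div 2) else c)"
    by (subst pad_nth) (auto simp: m nat_add_distrib)
  also have "\<dots> = (if odd m then x ((m + 1) div 2) else c)"
  proof (cases "odd k")
    case True
    then obtain j where j: "k = 2 * j + 1" by (elim oddE)
    then have "m + 1 = 2 * (- int j)" by (simp add: m)
    then have "(m + 1) div 2 = - int j" by (simp only: nonzero_mult_div_cancel_left)
    then show ?thesis using j by (simp add: m)
  qed (simp add: m)
  finally show ?thesis using False by (simp add: image_word_def m)
qed

lemma shift_funpow: "(shift ^^ k) x = (\<lambda>n. x (n + int k))"
  by (induction k) (auto simp: shift_def algebra_simps)

text \<open>The parity of the marker positions fixes the offset, which is 0 or 1; the other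
  positions then spell out the point.\<close>

lemma recognizable_pad:
  assumes "X \<subseteq> {x. range x \<subseteq> A}" "c \<notin> A"
  shows "recognizable_in B (pad c) X"
  unfolding recognizable_in_def
proof (intro ballI allI impI)
  fix x x' y and k l :: nat
  assume x: "x \<in> X" "x' \<in> X" and kl: "k < length (pad c [x 1])" "l < length (pad c [x' 1])"
    and "y = (shift ^^ k) (image_word (pad c) x)" "y = (shift ^^ l) (image_word (pad c) x')"
  then have eq: "image_word (pad c) x (n + int k) = image_word (pad c) x' (n + int l)" for n
    unfolding shift_funpow by metis
  have ne: "x n \<noteq> c" "x' n \<noteq> c" for n using x assms by auto
  have kl2: "k < 2" "l < 2" using kl by simp_all
  have "even k = even l"
    using eq[of 0] ne unfolding image_word_pad by (auto split: if_splits)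
  then have "k = l" using kl2 by (auto simp: less_2_cases_iff)
  moreover have "x n = x' n" for n
    \<comment> \<open>Chosen so that adding the offset gives \<open>2 * n - 1\<close>, the position
      of \<open>x n\<close>.\<close>
    using eq[of "2 * n - 1 - int k"] \<open>k = l\<close> by (simp add: image_word_pad)
  ultimately show "x = x' \<and> k = l" by auto
qed

lemma pad_morphism: "A \<subseteq> B \<Longrightarrow> c \<in> B \<Longrightarrow> monoid_morphism A B (pad c)"
proof -
  assume "A \<subseteq> B" "c \<in> B"
  then have "pad c w \<in> lists B" if "w \<in> lists A" for w
    using that by (induction w) auto
  then show ?thesis by (simp add: monoid_morphism_def)
qed

section \<open>Entropy of the full shift\<close>

lemma subshift_full: "A \<noteq> {} \<Longrightarrow> subshift A {x. range x \<subseteq> A}"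
proof -
  assume "A \<noteq> {}"
  then obtain a where "a \<in> A" by blast
  then have "(\<lambda>_. a) \<in> {x :: int \<Rightarrow> 'a. range x \<subseteq> A}" by auto
  moreover have "closedin (full_shift A) {x. range x \<subseteq> A}"
    using closedin_topspace[of "full_shift A"] by (simp add: topspace_full_shift)
  moreover have "shift ` {x. range x \<subseteq> A} = {x. range x \<subseteq> A}"
  proof (intro subset_antisym subsetI)
    fix x :: "int \<Rightarrow> 'a" assume "x \<in> {x. range x \<subseteq> A}"
    then have "(\<lambda>n. x (n - 1)) \<in> {x. range x \<subseteq> A}" by auto
    moreover have "x = shift (\<lambda>n. x (n - 1))" by (simp add: shift_def)
    ultimately show "x \<in> shift ` {x. range x \<subseteq> A}" by blast
  qed (auto simp: shift_def)
  ultimately show ?thesis unfolding subshift_def by blast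
qed

lemma language_full:
  assumes "A \<noteq> {}"
  shows "language {x. range x \<subseteq> A} = lists A"
proof (intro subset_antisym subsetI)
  fix w assume w: "w \<in> lists A"
  obtain a where "a \<in> A" using assms by blast
  \<comment> \<open>Any word extends to a point of the full shift by a constant letter on both
    sides.\<close>
  define x where "x n = (if 0 \<le> n \<and> nat n < length w then w ! nat n else a)" for n :: int
  have "x \<in> {x. range x \<subseteq> A}" using w \<open>a \<in> A\<close> by (auto simp: x_def in_lists_conv_set)
  moreover have "w = block x 0 (length w)" by (rule nth_equalityI) (auto simp: x_def)
  ultimately show "w \<in> language {x. range x \<subseteq> A}" using block_in_language by metis
qed (rule language_in_lists[OF subset_refl])

lemma entropy_full:
  fixes A :: "'a set"
  assumes "finite A" "A \<noteq> {}"
  shows "entropy {x. range x \<subseteq> A} = ln (real (card A))"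
proof -
  have "complexity {x. range x \<subseteq> A} n = card A ^ n" for n
    using card_lists_length_eq[OF assms(1), of n]
    unfolding complexity_def language_full[OF assms(2)] lists_eq_set by simp
  moreover have "card A > 0" using assms by (simp add: card_gt_0_iff)
  ultimately have "ln (real (complexity {x. range x \<subseteq> A} n)) / real n = ln (real (card A))"
    if "0 < n" for n
    using that by (simp add: ln_realpow)
  \<comment> \<open>Only for positive \<open>n\<close>: division by 0 makes the quotient 0 at
    \<open>n = 0\<close>.\<close>
  then have "\<forall>\<^sub>F n in sequentially.
      ln (real (complexity {x. range x \<subseteq> A} n)) / real n = ln (real (card A))"
    using eventually_gt_at_top[of 0] by (rule eventually_mono[rotated])
  then have "(\<lambda>n. ln (real (complexity {x. range x \<subseteq> A} n)) / real n) \<longlonglongrightarrow> ln (real (card A))"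
    by (rule tendsto_eventually)
  then show ?thesis using LIMSEQ_unique[OF entropy_LIMSEQ[OF assms(1) subset_refl]] by blast
qed

section \<open>The entropy comparison and the strict example\<close>

theorem corollary4p1:
  shows
    "(\<forall>(A :: 'a set) (B :: 'b set) X \<sigma>.
        finite A \<and> A \<noteq> {} \<and> finite B \<and> B \<noteq> {} \<and>
        subshift A X \<and> monoid_morphism A B \<sigma> \<and> non_erasing A \<sigma> \<longrightarrow>
        entropy (image_subshift B \<sigma> X) \<le> entropy X \<and>
        (recognizable_in B \<sigma> X \<and> letter_to_letter A \<sigma> \<longrightarrow>
          entropy (image_subshift B \<sigma> X) = entropy X)) \<and>
     (\<exists>(A :: nat set) (B :: nat set) X \<sigma>.
        finite A \<and> A \<noteq> {} \<and> finite B \<and> B \<noteq> {} \<and>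
        subshift A X \<and> monoid_morphism A B \<sigma> \<and> non_erasing A \<sigma> \<and>
        recognizable_in B \<sigma> X \<and> \<not> letter_to_letter A \<sigma> \<and>
        entropy (image_subshift B \<sigma> X) < entropy X)"
proof (intro conjI allI impI)
  fix A :: "'a set" and B :: "'b set" and X \<sigma>
  assume *: "finite A \<and> A \<noteq> {} \<and> finite B \<and> B \<noteq> {} \<and>
        subshift A X \<and> monoid_morphism A B \<sigma> \<and> non_erasing A \<sigma>"
  then have XA: "X \<subseteq> {x. range x \<subseteq> A}" using subshift_subset by blast
  \<comment> \<open>Non-erasing is the case \<open>d = 1\<close> of the upper bound.\<close>
  have "1 \<le> length (\<sigma> [a])" if "a \<in> A" for a
    using * that by (simp add: non_erasing_def Suc_le_eq)
  then show le: "entropy (image_subshift B \<sigma> X) \<le> entropy X"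
    using entropy_image_subshift_le[of A B \<sigma> X 1] * XA by simp
  assume rl: "recognizable_in B \<sigma> X \<and> letter_to_letter A \<sigma>"
  have "entropy X \<le> entropy (image_subshift B \<sigma> X)"
  proof (rule entropy_le_of_injective_block_code[OF _ _ _ image_subshift_subset])
    show "inj_on (\<lambda>x n. hd (\<sigma> [x n])) X"
      using recognizable_letter_to_letter_inj * rl XA by blast
    show "(\<lambda>n. hd (\<sigma> [x n])) \<in> image_subshift B \<sigma> X" if "x \<in> X" for x
      using letter_to_letter_image_in[of A B \<sigma> x X] * rl XA that by auto
  qed (use * in auto)
  with le show "entropy (image_subshift B \<sigma> X) = entropy X" by simp
next
  let ?A = "{0, 1} :: nat set" and ?B = "{0, 1, 2} :: nat set"
  let ?X = "{x. range x \<subseteq> ?A}"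
  \<comment> \<open>The marker 2 lies outside \<open>?A\<close>. All letter images have length 2, so
    the image has entropy at most half of \<open>ln 2\<close>, which is positive.\<close>
  have \<sigma>: "monoid_morphism ?A ?B (pad 2)" by (rule pad_morphism) auto
  have "entropy (image_subshift ?B (pad 2) ?X) \<le> entropy ?X / real 2"
    by (rule entropy_image_subshift_le[OF _ _ \<sigma>]) auto
  moreover have "entropy ?X = ln 2" using entropy_full[of ?A] by simp
  ultimately have "entropy (image_subshift ?B (pad 2) ?X) < entropy ?X"
    using ln_gt_zero[of "2::real"] by linarith
  moreover have "recognizable_in ?B (pad 2) ?X"
    by (rule recognizable_pad[of _ ?A]) auto
  moreover have "non_erasing ?A (pad 2)" "\<not> letter_to_letter ?A (pad 2)"
    by (auto simp: non_erasing_def letter_to_letter_def)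
  moreover have "subshift ?A ?X" by (rule subshift_full) blast
  moreover have "finite ?A" "?A \<noteq> {}" "finite ?B" "?B \<noteq> {}" by auto
  ultimately show "\<exists>(A :: nat set) (B :: nat set) X \<sigma>.
        finite A \<and> A \<noteq> {} \<and> finite B \<and> B \<noteq> {} \<and>
        subshift A X \<and> monoid_morphism A B \<sigma> \<and> non_erasing A \<sigma> \<and>
        recognizable_in B \<sigma> X \<and> \<not> letter_to_letter A \<sigma> \<and>
        entropy (image_subshift B \<sigma> X) < entropy X"
    using \<sigma> by blast
qed

end
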